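(* Let $n\ge 2$ and let $M=\mathbf X(U)\subset\mathbb R^{n+1}_1$ be a connected spacelike surface of codimension two. The following statements are equivalent: (1) there exist $r>0$ and a sign $*\in\{+,-\}$ such that $M$ is $\mathbf n_r^{*}$-flat; (2) there exist $r>0$ and a sign $*\in\{+,-\}$ such that $\mathbf n_r^{*}$ is constant on $M$; (3) there exist a spacelike vector $\mathbf a=(a_1,\dots,a_n,a_{n+1})$ with $a_{n+1}\neq 0$ and a real number $c$ such that $M\subset HP(\mathbf a,c)$.
   Context: $\mathbb R^{n+1}_1$ is $\mathbb R^{n+1}$ with the pseudo scalar product $\langle \mathbf x,\mathbf y\rangle=\sum_{i=1}^n x_iy_i-x_{n+1}y_{n+1}$; a nonzero vector $\mathbf x$ is spacelike if $\langle\mathbf x,\mathbf x\rangle>0$. For a nonzero vector $\mathbf a$ and $c\in\mathbb R$, $HP(\mathbf a,c)=\{\mathbf x:\langle\mathbf x,\mathbf a\rangle=c\}$. A spacelike surface of codimension two is $M=\mathbf X(U)$, where $\mathbf X:U\to\mathbb R^{n+1}_1$ is a smooth embedding of an open domain $U\subset\mathbb R^{n-1}$ such that $\langle\cdot,\cdot\rangle$ is positive definite on every tangent space $T_pM$. The normal plane $N_pM$ (the pseudo-orthogonal complement of $T_pM$) is a timelike 2-plane through the origin, and $\mathbb R^{n+1}_1=T_pM\oplus N_pM$. Let $\mathbf v=(0,\dots,0,-1)$, $H^n_+(\mathbf v,1)=\{\mathbf x:\langle \mathbf x-\mathbf v,\mathbf x-\mathbf v\rangle=-1,\ x_{n+1}+1\ge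 0\}$. For $r>0$ and $p\in M$, the set $N_pM\cap H^n_+(\mathbf v,1)\cap\{x_{n+1}=r\}$ consists of exactly two points, denoted $\mathbf n_r^{\pm}(p)$, labelled so that $\mathbf n_r^{\pm}$ are smooth normal vector fields on $M$. For $*\in\{+,-\}$ the $\mathbf n_r^{*}$-Weingarten map at $p$ is $A_p^{\mathbf n_r^*}=-(d\mathbf n_r^{*}(p))^{T}:T_pM\to T_pM$, where $T$ denotes the $T_pM$-component; it is self-adjoint. Its eigenvalues $k_1^{\mathbf n_r^*}(p),\dots,k_{n-1}^{\mathbf n_r^*}(p)$ are the $\mathbf n_r^*$-principal curvatures. $M$ is $\mathbf n_r^*$-flat if all $\mathbf n_r^*$-principal curvatures vanish at every $p\in M$ (equivalently $A_p^{\mathbf n_r^*}=0$ for all $p$). *)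

theory Defs
  imports "HOL-Analysis.Analysis"
begin

text \<open>Lorentz-Minkowski space of dimension \<open>n + 1\<close> is modelled on \<open>(real ^ 'n) \<times> real\<close> with
  \<open>CARD('n) = n\<close>: the second component is the (timelike) last coordinate.\<close>

definition lorentz :: "(real ^ 'n) \<times> real \<Rightarrow> (real ^ 'n) \<times> real \<Rightarrow> real" where
  "lorentz x y = fst x \<bullet> fst y - snd x * snd y"

definition spacelike :: "(real ^ 'n) \<times> real \<Rightarrow> bool" where
  "spacelike x \<longleftrightarrow> x \<noteq> 0 \<and> lorentz x x > 0"

definition hyperplane :: "(real ^ 'n) \<times> real \<Rightarrow> real \<Rightarrow> ((real ^ 'n) \<times> real) set" where
  "hyperplane a c = {x. lorentz x a = c}"

definition hyp_center :: "(real ^ 'n) \<times> real" where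
  "hyp_center = (0, -1)"

definition hyp_plus :: "((real ^ 'n) \<times> real) set" where
  "hyp_plus = {x. lorentz (x - hyp_center) (x - hyp_center) = -1 \<and> snd x + 1 \<ge> 0}"

text \<open>Intended for open sets: all iterated directional derivatives of order at most \<open>k\<close> exist,
  those of order less than \<open>k\<close> are differentiable, and those of order \<open>k\<close> are continuous.\<close>

primrec Ck_on :: "nat \<Rightarrow> 'a::real_normed_vector set \<Rightarrow> ('a \<Rightarrow> 'b::real_normed_vector) \<Rightarrow> bool" where
  "Ck_on 0 S f \<longleftrightarrow> continuous_on S f"
| "Ck_on (Suc k) S f \<longleftrightarrow>
     (\<forall>x\<in>S. f differentiable (at x)) \<and> (\<forall>h. Ck_on k S (\<lambda>x. frechet_derivative f (at x) h))"

definition smooth_on :: "'a::real_normed_vector set \<Rightarrow> ('a \<Rightarrow> 'b::real_normed_vector) \<Rightarrow> bool" where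
  "smooth_on S f \<longleftrightarrow> (\<forall>k. Ck_on k S f)"

text \<open>Objects on the surface \<open>M = X ` U\<close> are indexed by its points \<open>p\<close>; the parameter of \<open>p\<close> is
  \<open>the_inv_into U X p\<close>, as \<open>X\<close> is injective on \<open>U\<close>.\<close>

definition tangent_space ::
  "(real ^ 'm) set \<Rightarrow> (real ^ 'm \<Rightarrow> (real ^ 'n) \<times> real) \<Rightarrow> (real ^ 'n) \<times> real \<Rightarrow> ((real ^ 'n) \<times> real) set"
  where "tangent_space U X p = range (frechet_derivative X (at (the_inv_into U X p)))"

definition normal_plane ::
  "(real ^ 'm) set \<Rightarrow> (real ^ 'm \<Rightarrow> (real ^ 'n) \<times> real) \<Rightarrow> (real ^ 'n) \<times> real \<Rightarrow> ((real ^ 'n) \<times> real) set"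
  where "normal_plane U X p = {x. \<forall>w\<in>tangent_space U X p. lorentz x w = 0}"

definition spacelike_surface ::
  "(real ^ 'm) set \<Rightarrow> (real ^ 'm \<Rightarrow> (real ^ 'n) \<times> real) \<Rightarrow> bool"
  where "spacelike_surface U X \<longleftrightarrow>
    open U \<and> smooth_on U X \<and>
    (\<forall>u\<in>U. inj (frechet_derivative X (at u))) \<and>
    (\<exists>Y. homeomorphism U (X ` U) X Y) \<and>
    (\<forall>p\<in>X ` U. \<forall>w\<in>tangent_space U X p. w \<noteq> 0 \<longrightarrow> lorentz w w > 0)"

text \<open>A field \<open>N\<close> on \<open>M\<close> is smooth iff \<open>N \<circ> X\<close> is smooth on \<open>U\<close>. For fixed \<open>r\<close>, the pair
  \<open>Np, Nm\<close> is a smooth labelling of the two points of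
  \<open>normal_plane U X p \<inter> hyp_plus \<inter> {x. snd x = r}\<close>.\<close>

definition normal_labelling ::
  "(real ^ 'm) set \<Rightarrow> (real ^ 'm \<Rightarrow> (real ^ 'n) \<times> real) \<Rightarrow> real \<Rightarrow>
   ((real ^ 'n) \<times> real \<Rightarrow> (real ^ 'n) \<times> real) \<Rightarrow> ((real ^ 'n) \<times> real \<Rightarrow> (real ^ 'n) \<times> real) \<Rightarrow> bool"
  where "normal_labelling U X r Np Nm \<longleftrightarrow>
    smooth_on U (Np \<circ> X) \<and> smooth_on U (Nm \<circ> X) \<and>
    (\<forall>p\<in>X ` U. Np p \<noteq> Nm p \<and>
       normal_plane U X p \<inter> hyp_plus \<inter> {x. snd x = r} = {Np p, Nm p})"

text \<open>The differential at \<open>p = X u\<close> of a field \<open>N\<close> on \<open>M\<close>, characterised on tangent vectors by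
  \<open>dN(p) (dX(u) h) = d(N \<circ> X)(u) h\<close>; values at non-tangent \<open>w\<close> are irrelevant.\<close>

definition surface_differential ::
  "(real ^ 'm) set \<Rightarrow> (real ^ 'm \<Rightarrow> (real ^ 'n) \<times> real) \<Rightarrow>
   ((real ^ 'n) \<times> real \<Rightarrow> (real ^ 'n) \<times> real) \<Rightarrow>
   (real ^ 'n) \<times> real \<Rightarrow> (real ^ 'n) \<times> real \<Rightarrow> (real ^ 'n) \<times> real"
  where "surface_differential U X N p w =
    (let u = the_inv_into U X p
     in frechet_derivative (N \<circ> X) (at u) (the_inv (frechet_derivative X (at u)) w))"

definition tangential_part ::
  "(real ^ 'm) set \<Rightarrow> (real ^ 'm \<Rightarrow> (real ^ 'n) \<times> real) \<Rightarrow>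
   (real ^ 'n) \<times> real \<Rightarrow> (real ^ 'n) \<times> real \<Rightarrow> (real ^ 'n) \<times> real"
  where "tangential_part U X p x =
    (THE t. t \<in> tangent_space U X p \<and> x - t \<in> normal_plane U X p)"

definition weingarten_map ::
  "(real ^ 'm) set \<Rightarrow> (real ^ 'm \<Rightarrow> (real ^ 'n) \<times> real) \<Rightarrow>
   ((real ^ 'n) \<times> real \<Rightarrow> (real ^ 'n) \<times> real) \<Rightarrow>
   (real ^ 'n) \<times> real \<Rightarrow> (real ^ 'n) \<times> real \<Rightarrow> (real ^ 'n) \<times> real"
  where "weingarten_map U X N p w = - tangential_part U X p (surface_differential U X N p w)"

text \<open>The set of eigenvalues of the Weingarten map on the tangent space (multiplicities are not
  recorded; real eigenvalues suffice since the map is self-adjoint).\<close>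

definition principal_curvatures ::
  "(real ^ 'm) set \<Rightarrow> (real ^ 'm \<Rightarrow> (real ^ 'n) \<times> real) \<Rightarrow>
   ((real ^ 'n) \<times> real \<Rightarrow> (real ^ 'n) \<times> real) \<Rightarrow> (real ^ 'n) \<times> real \<Rightarrow> real set"
  where "principal_curvatures U X N p =
    {k. \<exists>w\<in>tangent_space U X p. w \<noteq> 0 \<and> weingarten_map U X N p w = k *\<^sub>R w}"

definition flat_surface ::
  "(real ^ 'm) set \<Rightarrow> (real ^ 'm \<Rightarrow> (real ^ 'n) \<times> real) \<Rightarrow>
   ((real ^ 'n) \<times> real \<Rightarrow> (real ^ 'n) \<times> real) \<Rightarrow> bool"
  where "flat_surface U X N \<longleftrightarrow> (\<forall>p\<in>X ` U. \<forall>k\<in>principal_curvatures U X N p. k = 0)"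

end

theory Submission
  imports Defs
begin

text \<open>A point of \<open>hyp_plus\<close> at height \<open>r\<close> is a vector with last coordinate \<open>r\<close> and Lorentz square
  \<open>2 r\<close>. Flatness gives constancy as follows. Differentiating
  \<open>\<langle>N, dX k\<rangle> = 0\<close> yields \<open>\<langle>dN h, dX k\<rangle> = - \<langle>N, d\<^sup>2X (h, k)\<rangle>\<close>, which is symmetric, so the
  extremal values of its Rayleigh quotient are principal curvatures; if those vanish, \<open>dN\<close> is
  normal. As the height and the Lorentz square of \<open>N\<close> are constant, \<open>dN\<close> is moreover
  horizontal and orthogonal to \<open>N\<close>, and the horizontal line in the normal plane is not
  orthogonal to \<open>N\<close>; hence \<open>dN = 0\<close>. Conversely, a spacelike vector with nonzero
  last coordinate that is normal to \<open>M\<close> has exactly one multiple in \<open>hyp_plus\<close> at a height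
  \<open>r > 0\<close>, and connectedness forces this multiple to coincide with one of the two branches.\<close>

section \<open>Symmetry of second derivatives\<close>

lemma has_derivative_along_line:
  assumes "f differentiable (at (x + s *\<^sub>R h))"
  shows "((\<lambda>s. f (x + s *\<^sub>R h)) has_vector_derivative frechet_derivative f (at (x + s *\<^sub>R h)) h) (at s)"
proof -
  have f: "(f has_derivative frechet_derivative f (at (x + s *\<^sub>R h))) (at (x + s *\<^sub>R h))"
    using assms frechet_derivative_works by blast
  have "((\<lambda>s. x + s *\<^sub>R h) has_derivative (\<lambda>t. t *\<^sub>R h)) (at s)"
    by (auto intro!: derivative_eq_intros)
  from diff_chain_at[OF this f] show ?thesis
    using linear_scale[OF has_derivative_linear[OF f]]
    by (simp add: has_vector_derivative_def o_def)
qed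

text \<open>Two applications of the mean value theorem: first along \<open>h\<close> to the
  increment of \<open>f\<close> in direction \<open>k\<close>, then along \<open>k\<close> to the
  derivative of \<open>f\<close> in direction \<open>h\<close>. Pairing with \<open>b\<close>
  reduces to real-valued functions, since the theorem fails for vector values; the intermediate
  point therefore depends on \<open>b\<close>.\<close>

lemma second_difference_mean_value:
  fixes f :: "'a::real_normed_vector \<Rightarrow> 'b::real_inner"
  assumes "t > 0"
    and S: "\<And>a c. \<lbrakk>0 \<le> a; a \<le> t; 0 \<le> c; c \<le> t\<rbrakk> \<Longrightarrow> x + a *\<^sub>R h + c *\<^sub>R k \<in> S"
    and d1: "\<And>y. y \<in> S \<Longrightarrow> f differentiable (at y)"
    and d2: "\<And>y. y \<in> S \<Longrightarrow> (\<lambda>y. frechet_derivative f (at y) h) differentiable (at y)"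
  shows "\<exists>a\<in>{0..t}. \<exists>c\<in>{0..t}.
     (f (x + t *\<^sub>R h + t *\<^sub>R k) - f (x + t *\<^sub>R h) - f (x + t *\<^sub>R k) + f x) \<bullet> b =
     t\<^sup>2 * (frechet_derivative (\<lambda>y. frechet_derivative f (at y) h) (at (x + a *\<^sub>R h + c *\<^sub>R k)) k \<bullet> b)"
proof -
  define Dh where "Dh y = frechet_derivative f (at y) h" for y
  have S0: "x + a *\<^sub>R h \<in> S" if "0 \<le> a" "a \<le> t" for a
    using S[of a 0] that \<open>t > 0\<close> by simp
  have St: "(x + t *\<^sub>R k) + a *\<^sub>R h \<in> S" if "0 \<le> a" "a \<le> t" for a
    using S[of a t] that \<open>t > 0\<close> by (simp add: algebra_simps)
  define g where "g a = (f ((x + t *\<^sub>R k) + a *\<^sub>R h) - f (x + a *\<^sub>R h)) \<bullet> b" for a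
  have "(g has_real_derivative
      (Dh ((x + t *\<^sub>R k) + a *\<^sub>R h) - Dh (x + a *\<^sub>R h)) \<bullet> b) (at a)" if "0 \<le> a" "a \<le> t" for a
    unfolding g_def has_real_derivative_iff_has_vector_derivative Dh_def
    by (intro bounded_linear.has_vector_derivative[OF bounded_linear_inner_left]
        has_vector_derivative_diff has_derivative_along_line d1 St S0 that)
  from MVT2[OF \<open>t > 0\<close> this] obtain a where a: "0 < a" "a < t"
    "g t - g 0 = t * ((Dh ((x + t *\<^sub>R k) + a *\<^sub>R h) - Dh (x + a *\<^sub>R h)) \<bullet> b)"
    by auto
  define e where "e c = Dh ((x + a *\<^sub>R h) + c *\<^sub>R k) \<bullet> b" for c
  have "(e has_real_derivative
      frechet_derivative Dh (at ((x + a *\<^sub>R h) + c *\<^sub>R k)) k \<bullet> b) (at c)"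
    if "0 \<le> c" "c \<le> t" for c
    unfolding e_def has_real_derivative_iff_has_vector_derivative Dh_def
    using a that S[of a c]
    by (intro bounded_linear.has_vector_derivative[OF bounded_linear_inner_left]
        has_derivative_along_line d2) simp_all
  from MVT2[OF \<open>t > 0\<close> this] obtain c where c: "0 < c" "c < t"
    "e t - e 0 = t * (frechet_derivative Dh (at ((x + a *\<^sub>R h) + c *\<^sub>R k)) k \<bullet> b)"
    by auto
  have "(f (x + t *\<^sub>R h + t *\<^sub>R k) - f (x + t *\<^sub>R h) - f (x + t *\<^sub>R k) + f x) \<bullet> b = g t - g 0"
    by (simp add: g_def inner_simps add_ac)
  also have "\<dots> = t * (e t - e 0)"
    using a(3) by (simp add: e_def inner_simps add_ac)
  also have "\<dots> = t\<^sup>2 * (frechet_derivative Dh (at (x + a *\<^sub>R h + c *\<^sub>R k)) k \<bullet> b)"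
    using c(3) by (simp add: power2_eq_square)
  finally show ?thesis
    using a(1,2) c(1,2) unfolding Dh_def by (intro bexI[of _ a] bexI[of _ c]) auto
qed

text \<open>The second difference over the parallelogram spanned by \<open>t *\<^sub>R h\<close> and
  \<open>t *\<^sub>R k\<close> is unchanged when \<open>h\<close> and \<open>k\<close> are swapped.
  So the two mixed derivatives, paired with any \<open>b\<close>, agree at suitable points
  arbitrarily near \<open>x\<close>, and continuity carries the equality to
  \<open>x\<close>.\<close>

lemma symmetric_second_derivative:
  fixes f :: "'a::real_normed_vector \<Rightarrow> 'b::real_inner"
  assumes "open S" "x \<in> S" "Ck_on 2 S f"
  shows "frechet_derivative (\<lambda>y. frechet_derivative f (at y) h) (at x) k =
         frechet_derivative (\<lambda>y. frechet_derivative f (at y) k) (at x) h"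
proof -
  define G where "G h k y = frechet_derivative (\<lambda>y. frechet_derivative f (at y) h) (at y) k" for h k y
  have d1: "f differentiable (at y)" if "y \<in> S" for y
    using assms(3) that by (simp add: numeral_2_eq_2)
  have d2: "(\<lambda>y. frechet_derivative f (at y) h) differentiable (at y)" if "y \<in> S" for y h
    using assms(3) that by (simp add: numeral_2_eq_2)
  have "continuous_on S (G h k)" for h k
    using assms(3) unfolding G_def by (simp add: numeral_2_eq_2)
  then have "isCont (\<lambda>y. G h k y \<bullet> b) x" for h k b
    using assms(1,2) by (intro continuous_intros) (simp add: continuous_on_eq_continuous_at)
  \<comment> \<open>The filter is \<open>nhds x\<close>, not \<open>at x\<close>, because the
    intermediate points may coincide with \<open>x\<close>.\<close>
  then have cont: "((\<lambda>y. G h k y \<bullet> b) \<longlongrightarrow> G h k x \<bullet> b) (nhds x)" for h k b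
    unfolding isCont_def
    using tendsto_at_iff_tendsto_nhds[of "\<lambda>y. G h k y \<bullet> b" x] by blast
  have "\<bar>G h k x \<bullet> b - G k h x \<bullet> b\<bar> \<le> 0 + e" if "e > 0" for b and e :: real
  proof -
    have "\<forall>\<^sub>F y in nhds x. y \<in> S \<and> dist (G h k y \<bullet> b) (G h k x \<bullet> b) < e / 2 \<and>
        dist (G k h y \<bullet> b) (G k h x \<bullet> b) < e / 2"
      using assms(1,2) cont[of h k b] cont[of k h b] that
      by (intro eventually_conj eventually_nhds_in_open tendstoD) simp_all
    then obtain d where "d > 0" and d: "\<And>y. dist y x < d \<Longrightarrow> y \<in> S \<and>
        dist (G h k y \<bullet> b) (G h k x \<bullet> b) < e / 2 \<and> dist (G k h y \<bullet> b) (G k h x \<bullet> b) < e / 2"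
      unfolding eventually_nhds_metric by blast
    \<comment> \<open>This scale keeps the whole parallelogram within distance \<open>d\<close> of
      \<open>x\<close>; the summand 1 gives a positive denominator and a strict bound even when
      \<open>h\<close> and \<open>k\<close> vanish.\<close>
    define t where "t = d / (norm h + norm k + 1)"
    have pos: "norm h + norm k + 1 > 0"
      by (simp add: add_nonneg_pos)
    then have "t > 0"
      using \<open>d > 0\<close> by (simp add: t_def)
    have near: "dist (x + a *\<^sub>R h + c *\<^sub>R k) x < d"
      if "0 \<le> a" "a \<le> t" "0 \<le> c" "c \<le> t" for a c
    proof -
      have "norm (a *\<^sub>R h + c *\<^sub>R k) \<le> a * norm h + c * norm k"
        using norm_triangle_ineq[of "a *\<^sub>R h" "c *\<^sub>R k"] that by simp
      also have "\<dots> \<le> t * norm h + t * norm k"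
        using that by (intro add_mono mult_right_mono) auto
      also have "\<dots> < t * (norm h + norm k + 1)"
        using \<open>t > 0\<close> by (simp add: algebra_simps)
      also have "\<dots> = d"
        using pos by (simp add: t_def)
      finally show ?thesis
        by (simp add: dist_norm add.assoc)
    qed
    have near': "dist (x + a *\<^sub>R k + c *\<^sub>R h) x < d"
      if "0 \<le> a" "a \<le> t" "0 \<le> c" "c \<le> t" for a c
      using near[of c a] that by (simp add: add_ac)
    have S: "x + a *\<^sub>R h + c *\<^sub>R k \<in> S" "x + a *\<^sub>R k + c *\<^sub>R h \<in> S"
      if "0 \<le> a" "a \<le> t" "0 \<le> c" "c \<le> t" for a c
      using d near near' that by blast+
    obtain a c where ac: "0 \<le> a" "a \<le> t" "0 \<le> c" "c \<le> t"
      "(f (x + t *\<^sub>R h + t *\<^sub>R k) - f (x + t *\<^sub>R h) - f (x + t *\<^sub>R k) + f x) \<bullet> b =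
         t\<^sup>2 * (G h k (x + a *\<^sub>R h + c *\<^sub>R k) \<bullet> b)"
      using second_difference_mean_value[OF \<open>t > 0\<close> S(1) d1 d2, of b] unfolding G_def by auto
    obtain a' c' where ac': "0 \<le> a'" "a' \<le> t" "0 \<le> c'" "c' \<le> t"
      "(f (x + t *\<^sub>R k + t *\<^sub>R h) - f (x + t *\<^sub>R k) - f (x + t *\<^sub>R h) + f x) \<bullet> b =
         t\<^sup>2 * (G k h (x + a' *\<^sub>R k + c' *\<^sub>R h) \<bullet> b)"
      using second_difference_mean_value[OF \<open>t > 0\<close> S(2) d1 d2, of b] unfolding G_def by auto
    have "t\<^sup>2 * (G h k (x + a *\<^sub>R h + c *\<^sub>R k) \<bullet> b) = t\<^sup>2 * (G k h (x + a' *\<^sub>R k + c' *\<^sub>R h) \<bullet> b)"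
      unfolding ac(5)[symmetric] ac'(5)[symmetric] by (simp add: algebra_simps)
    then have "G h k (x + a *\<^sub>R h + c *\<^sub>R k) \<bullet> b = G k h (x + a' *\<^sub>R k + c' *\<^sub>R h) \<bullet> b"
      using \<open>t > 0\<close> by simp
    then show ?thesis
      using d[OF near[OF ac(1-4)]] d[OF near'[OF ac'(1-4)]] unfolding dist_real_def by linarith
  qed
  then have "\<bar>G h k x \<bullet> b - G k h x \<bullet> b\<bar> \<le> 0" for b
    by (rule field_le_epsilon)
  then have "G h k x = G k h x"
    by (metis abs_le_zero_iff inner_diff_left inner_eq_zero_iff eq_iff_diff_eq_0)
  then show ?thesis
    by (simp add: G_def)
qed

lemma has_derivative_const_on_open:
  assumes "open S" "x \<in> S" "\<And>y. y \<in> S \<Longrightarrow> f y = c"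
  shows "(f has_derivative (\<lambda>_. 0)) (at x)"
  using has_derivative_transform_within_open[OF has_derivative_const assms(1,2)] assms(3) by metis

lemma has_derivative_zero_connected_const:
  assumes "open S" "connected S" "\<And>x. x \<in> S \<Longrightarrow> (f has_derivative (\<lambda>_. 0)) (at x)"
  shows "\<exists>c. \<forall>x\<in>S. f x = c"
  using has_derivative_zero_unique_connected[OF assms] by metis

section \<open>Rayleigh quotients\<close>

text \<open>The Rayleigh quotient attains its maximum \<open>l\<close> on the compact unit sphere,
  at \<open>h\<close> say. Then \<open>C = B - l * g\<close> is negative semidefinite and vanishes
  on the diagonal at \<open>h\<close>, which forces \<open>h\<close> into its kernel.\<close>

lemma ex_max_generalized_eigenvalue:
  fixes B g :: "'a::euclidean_space \<Rightarrow> 'a \<Rightarrow> real"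
  assumes B: "bilinear B" and g: "bilinear g"
    and B_sym: "\<And>h k. B h k = B k h" and g_sym: "\<And>h k. g h k = g k h"
    and g_pos: "\<And>h. h \<noteq> 0 \<Longrightarrow> g h h > 0"
  obtains l h where "h \<noteq> 0" "\<And>k. B h k = l * g h k" "\<And>k. B k k \<le> l * g k k"
proof -
  have "g h h \<noteq> 0" if "h \<in> sphere 0 1" for h
    using g_pos[of h] that by fastforce
  then have cont: "continuous_on (sphere 0 1) (\<lambda>h. B h h / g h h)"
    using B g
    by (intro continuous_intros bounded_bilinear.continuous_on[where prod=B]
        bounded_bilinear.continuous_on[where prod=g])
       (simp_all add: bilinear_conv_bounded_bilinear)
  obtain h where h: "h \<in> sphere 0 1"
    and max: "\<And>k. k \<in> sphere 0 1 \<Longrightarrow> B k k / g k k \<le> B h h / g h h"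
    using continuous_attains_sup[OF _ _ cont] by auto
  define l where "l = B h h / g h h"
  define C where "C h k = B h k - l * g h k" for h k
  have "h \<noteq> 0"
    using h by auto
  then have Chh: "C h h = 0"
    using g_pos[of h] by (simp add: C_def l_def)
  have C_le: "C k k \<le> 0" for k
  proof (cases "k = 0")
    case True
    then show ?thesis
      using B g by (simp add: C_def bilinear_lzero)
  next
    case False
    define j where "j = k /\<^sub>R norm k"
    have "j \<in> sphere 0 1" "j \<noteq> 0"
      using False by (simp_all add: j_def)
    then have "B j j \<le> l * g j j"
      using max[of j] g_pos[of j] by (simp add: l_def[symmetric] pos_divide_le_eq)
    then have "(norm k)\<^sup>2 * (B j j - l * g j j) \<le> 0"
      by (simp add: mult_nonneg_nonpos)
    moreover have "C (norm k *\<^sub>R j) (norm k *\<^sub>R j) = (norm k)\<^sup>2 * (B j j - l * g j j)"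
      using B g
      by (simp add: C_def bilinear_lmul bilinear_rmul power2_eq_square algebra_simps)
    moreover have "norm k *\<^sub>R j = k"
      using False by (simp add: j_def)
    ultimately show ?thesis
      by metis
  qed
  have "C h k = 0" for k
  proof (rule ccontr)
    assume neq: "C h k \<noteq> 0"
    \<comment> \<open>Along \<open>h + s *\<^sub>R k\<close> the linear term
      \<open>2 * s * C h k\<close> beats the quadratic one: with this \<open>s\<close> their sum is
      a positive multiple of \<open>s\<^sup>2\<close>, contradicting semidefiniteness.\<close>
    define s where "s = C h k / (\<bar>C k k\<bar> + 1)"
    have "C (h + s *\<^sub>R k) (h + s *\<^sub>R k) = C h h + 2 * s * C h k + s\<^sup>2 * C k k"
      using B g B_sym[of k h] g_sym[of k h]
      by (simp add: C_def bilinear_ladd bilinear_radd bilinear_lmul bilinear_rmul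
          algebra_simps power2_eq_square)
    then have le: "2 * s * C h k + s\<^sup>2 * C k k \<le> 0"
      using C_le[of "h + s *\<^sub>R k"] Chh by simp
    have C_s: "C h k = s * (\<bar>C k k\<bar> + 1)"
      by (simp add: s_def)
    have "2 * s * C h k + s\<^sup>2 * C k k = s\<^sup>2 * (2 * \<bar>C k k\<bar> + 2 + C k k)"
      by (subst C_s) (simp add: algebra_simps power2_eq_square)
    moreover have "s\<^sup>2 > 0"
      using neq by (simp add: s_def)
    ultimately show False
      using le by (simp add: mult_le_0_iff)
  qed
  then show ?thesis
    using that[of h l] \<open>h \<noteq> 0\<close> C_le by (simp add: C_def)
qed

text \<open>The maximal eigenvalues of \<open>B\<close> and of \<open>- B\<close> bound the
  quadratic form of \<open>B\<close> from above and below. Both are zero, so the form vanishes, and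
  polarization gives \<open>B = 0\<close>; no full diagonalization is required.\<close>

lemma bilinear_eq_0I:
  fixes B g :: "'a::euclidean_space \<Rightarrow> 'a \<Rightarrow> real"
  assumes B: "bilinear B" and g: "bilinear g"
    and B_sym: "\<And>h k. B h k = B k h" and g_sym: "\<And>h k. g h k = g k h"
    and g_pos: "\<And>h. h \<noteq> 0 \<Longrightarrow> g h h > 0"
    and eigen: "\<And>l h. \<lbrakk>h \<noteq> 0; \<And>k. B h k = l * g h k\<rbrakk> \<Longrightarrow> l = 0"
  shows "B h k = 0"
proof -
  obtain l h1 where l: "h1 \<noteq> 0" "\<And>k. B h1 k = l * g h1 k" "\<And>k. B k k \<le> l * g k k"
    using ex_max_generalized_eigenvalue[OF B g B_sym g_sym g_pos] by metis
  have B': "bilinear (\<lambda>h k. - B h k)"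
    using B unfolding bilinear_def by (auto intro: linear_compose_neg)
  obtain l' h2 where l': "h2 \<noteq> 0" "\<And>k. - B h2 k = l' * g h2 k" "\<And>k. - B k k \<le> l' * g k k"
    using ex_max_generalized_eigenvalue[OF B' g _ g_sym g_pos] B_sym by metis
  have "- l' = 0"
    using l'(2) by (intro eigen[OF l'(1)]) (metis minus_mult_left minus_minus)
  moreover have "l = 0"
    using eigen l by blast
  ultimately have diag: "B k k = 0" for k
    using l(3)[of k] l'(3)[of k] by simp
  have "B (h + k) (h + k) = B h h + B k k + 2 * B h k"
    using B B_sym[of k h] by (simp add: bilinear_ladd bilinear_radd)
  then show ?thesis
    by (simp add: diag)
qed

section \<open>Lorentz geometry of the surface\<close>

lemma bounded_bilinear_lorentz: "bounded_bilinear lorentz"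
  unfolding bilinear_conv_bounded_bilinear[symmetric] bilinear_def
  by (auto intro!: linearI simp: lorentz_def algebra_simps inner_simps)

interpretation lorentz: bounded_bilinear lorentz
  by (rule bounded_bilinear_lorentz)

lemma lorentz_commute: "lorentz x y = lorentz y x"
  by (simp add: lorentz_def inner_commute)

text \<open>At height \<open>r\<close> the vector \<open>x - hyp_center\<close> has last coordinate
  \<open>r + 1\<close>, so its Lorentz square is \<open>lorentz x x - 2 * r - 1\<close>; positivity
  of \<open>r\<close> places \<open>x\<close> on the upper sheet.\<close>

lemma hyp_plus_height_iff:
  assumes "r > 0"
  shows "x \<in> hyp_plus \<and> snd x = r \<longleftrightarrow> snd x = r \<and> lorentz x x = 2 * r"
  using assms
  by (auto simp: hyp_plus_def hyp_center_def lorentz_def algebra_simps)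

context
  fixes U :: "(real ^ 'm) set" and X :: "real ^ 'm \<Rightarrow> (real ^ 'n) \<times> real"
  assumes surf: "spacelike_surface U X"
begin

abbreviation dX :: "real ^ 'm \<Rightarrow> real ^ 'm \<Rightarrow> (real ^ 'n) \<times> real" where
  "dX u \<equiv> frechet_derivative X (at u)"

lemma open_parameters: "open U"
  using surf by (simp add: spacelike_surface_def)

lemma the_inv_into_parameter: "u \<in> U \<Longrightarrow> the_inv_into U X (X u) = u"
  using surf by (intro the_inv_into_f_f)
    (auto simp: spacelike_surface_def homeomorphism_def intro: inj_on_inverseI)

lemma Ck_on_surface: "Ck_on k U X"
  using surf by (simp add: spacelike_surface_def smooth_on_def)

lemma has_derivative_surface: "u \<in> U \<Longrightarrow> (X has_derivative dX u) (at u)"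
  using Ck_on_surface[of 1] frechet_derivative_works by auto

lemma linear_dX: "u \<in> U \<Longrightarrow> linear (dX u)"
  using has_derivative_surface has_derivative_linear by blast

lemma inj_dX: "u \<in> U \<Longrightarrow> inj (dX u)"
  using surf by (simp add: spacelike_surface_def)

lemma tangent_space_eq: "u \<in> U \<Longrightarrow> tangent_space U X (X u) = range (dX u)"
  by (simp add: tangent_space_def the_inv_into_parameter)

lemma normal_plane_iff:
  "u \<in> U \<Longrightarrow> x \<in> normal_plane U X (X u) \<longleftrightarrow> (\<forall>h. lorentz x (dX u h) = 0)"
  by (simp add: normal_plane_def tangent_space_eq)

lemma lorentz_dX_pos:
  assumes "u \<in> U" "h \<noteq> 0"
  shows "lorentz (dX u h) (dX u h) > 0"
proof -
  have "dX u h \<noteq> 0"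
    using assms linear_injective_0[OF linear_dX] inj_dX by blast
  moreover have "dX u h \<in> tangent_space U X (X u)"
    using assms by (simp add: tangent_space_eq)
  ultimately show ?thesis
    using surf assms(1) by (auto simp: spacelike_surface_def)
qed

text \<open>The difference of two candidates is both tangent and normal, so its Lorentz square is 0
  and positive definiteness makes it vanish. The definite description is thus evaluated wherever one
  decomposition is exhibited.\<close>

lemma tangential_part_eqI:
  assumes "u \<in> U" "\<And>k. lorentz (x - dX u h) (dX u k) = 0"
  shows "tangential_part U X (X u) x = dX u h"
  unfolding tangential_part_def
proof (rule the_equality)
  show "dX u h \<in> tangent_space U X (X u) \<and> x - dX u h \<in> normal_plane U X (X u)"
    using assms by (simp add: tangent_space_eq normal_plane_iff)
next
  fix t assume t: "t \<in> tangent_space U X (X u) \<and> x - t \<in> normal_plane U X (X u)"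
  then obtain h' where h': "t = dX u h'"
    using assms(1) by (auto simp: tangent_space_eq)
  have "lorentz (dX u (h - h')) (dX u (h - h')) =
      lorentz (x - t) (dX u (h - h')) - lorentz (x - dX u h) (dX u (h - h'))"
    using h' by (simp add: linear_diff[OF linear_dX[OF assms(1)]] lorentz.diff_left)
  also have "\<dots> = 0"
    using assms t by (simp add: normal_plane_iff)
  finally show "t = dX u h"
    using lorentz_dX_pos[OF assms(1), of "h - h'"] h' by fastforce
qed

lemma surface_differential_eq:
  "u \<in> U \<Longrightarrow> surface_differential U X N (X u) (dX u h) = frechet_derivative (N \<circ> X) (at u) h"
  by (simp add: surface_differential_def the_inv_into_parameter the_inv_f_f inj_dX)

text \<open>Pairing with tangent vectors discards the normal component. Eigenvectors of the
  Weingarten map can thus be recognized from a bilinear form relative to the induced metric; the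
  sign comes from the minus in its definition.\<close>

lemma weingarten_map_eqI:
  assumes "u \<in> U"
    and "\<And>k. lorentz (frechet_derivative (N \<circ> X) (at u) h) (dX u k) = - l * lorentz (dX u h) (dX u k)"
  shows "weingarten_map U X N (X u) (dX u h) = l *\<^sub>R dX u h"
proof -
  have scale: "dX u (- l *\<^sub>R h) = - l *\<^sub>R dX u h"
    by (rule linear_scale[OF linear_dX[OF assms(1)]])
  have "tangential_part U X (X u) (frechet_derivative (N \<circ> X) (at u) h) = dX u (- l *\<^sub>R h)"
    using assms unfolding scale[symmetric]
    by (intro tangential_part_eqI) (simp_all only: scale lorentz.diff_left lorentz.scaleR_left, simp)
  then show ?thesis
    using assms(1) scale by (simp add: weingarten_map_def surface_differential_eq)
qed

lemma flat_surface_const: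
  assumes "N constant_on X ` U"
  shows "flat_surface U X N"
  unfolding flat_surface_def
proof (intro ballI)
  fix p l assume "p \<in> X ` U" and l: "l \<in> principal_curvatures U X N p"
  then obtain u where u: "u \<in> U" "p = X u"
    by blast
  with l obtain h where h: "dX u h \<noteq> 0" "weingarten_map U X N (X u) (dX u h) = l *\<^sub>R dX u h"
    by (auto simp: principal_curvatures_def tangent_space_eq)
  obtain c where c: "\<And>u. u \<in> U \<Longrightarrow> (N \<circ> X) u = c"
    using assms by (auto simp: constant_on_def)
  have "((N \<circ> X) has_derivative (\<lambda>_. 0)) (at u)"
    using has_derivative_const_on_open[OF open_parameters u(1) c] .
  then have "frechet_derivative (N \<circ> X) (at u) = (\<lambda>_. 0)"
    by (metis frechet_derivative_at)
  then have "weingarten_map U X N (X u) (dX u h) = 0 *\<^sub>R dX u h"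
    by (intro weingarten_map_eqI u) (simp add: lorentz.zero_left)
  then show "l = 0"
    using h by simp
qed

text \<open>The horizontal parts of the tangent vectors and of \<open>N\<close> together span the
  Euclidean factor, by a dimension count. Geometrically, a horizontal vector \<open>(y, 0)\<close>
  that is normal to the surface and orthogonal to \<open>N\<close> is zero.\<close>

lemma fst_dX_normal_span:
  assumes m: "CARD('m) = CARD('n) - 1" and u: "u \<in> U"
    and N: "N \<in> normal_plane U X (X u)" "snd N \<noteq> 0" "lorentz N N > 0"
    and y: "\<And>h. y \<bullet> fst (dX u h) = 0" "y \<bullet> fst N = 0"
  shows "y = 0"
proof -
  define P where "P h = fst (dX u h)" for h
  have P: "linear P"
    unfolding P_def using linear_compose[OF linear_dX[OF u] linear_fst] by (simp add: o_def)
  have "inj P"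
    unfolding linear_injective_0[OF P]
  proof (intro allI impI)
    fix h assume "P h = 0"
    then have "lorentz (dX u h) (dX u h) \<le> 0"
      by (simp add: lorentz_def P_def)
    then show "h = 0"
      using lorentz_dX_pos[OF u] by fastforce
  qed
  then have dim: "dim (range P) = CARD('m)"
    using dim_image_eq[OF P, of UNIV] by (simp add: dim_UNIV)
  \<comment> \<open>Were \<open>fst N\<close> the horizontal part of a tangent vector with last
    coordinate \<open>s\<close>, then \<open>fst N \<bullet> fst N\<close> would equal
    \<open>snd N * s\<close> while exceeding both squares \<open>snd N * snd N\<close> and
    \<open>s * s\<close>, contradicting that \<open>snd N - s\<close> has nonnegative
    square.\<close>
  have notin: "fst N \<notin> range P"
  proof
    assume "fst N \<in> range P"
    then obtain h where h: "fst N = fst (dX u h)"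
      by (auto simp: P_def)
    define s where "s = snd (dX u h)"
    have 1: "fst N \<bullet> fst N = snd N * s"
      using N(1) u h by (simp add: normal_plane_iff lorentz_def s_def)
    have 2: "fst N \<bullet> fst N > snd N * snd N"
      using N(3) by (simp add: lorentz_def)
    have "h \<noteq> 0"
    proof
      assume "h = 0"
      then have "fst N = 0"
        using h linear_0[OF linear_dX[OF u]] by simp
      then show False
        using 2 by (metis inner_zero_left not_less zero_le_square)
    qed
    then have 3: "fst N \<bullet> fst N > s * s"
      using lorentz_dX_pos[OF u, of h] h by (simp add: lorentz_def s_def)
    have "0 \<le> (snd N - s) * (snd N - s)"
      by simp
    then show False
      using 1 2 3 by (simp add: algebra_simps)
  qed
  have "subspace (range P)"
    using linear_subspace_image[OF P] by simp
  \<comment> \<open>The truncated subtraction in \<open>m\<close> is harmless because cardinalities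
    of finite types are positive.\<close>
  then have "dim (insert (fst N) (range P)) = CARD('n)"
    using notin dim m zero_less_card_finite[where 'a='n] zero_less_card_finite[where 'a='m]
    by (simp add: dim_insert span_eq_iff[THEN iffD2])
  then have "span (insert (fst N) (range P)) = UNIV"
    by (metis dim_eq_full DIM_cart DIM_real mult.right_neutral)
  moreover have "orthogonal y z" if "z \<in> insert (fst N) (range P)" for z
    using that y by (auto simp: orthogonal_def P_def)
  ultimately have "orthogonal y y"
    using orthogonal_to_span[of y "insert (fst N) (range P)" y] by simp
  then show ?thesis
    by (simp add: orthogonal_def)
qed

section \<open>Derivatives of smooth normal fields\<close>

context
  fixes N :: "(real ^ 'n) \<times> real \<Rightarrow> (real ^ 'n) \<times> real"
  assumes smooth: "smooth_on U (N \<circ> X)"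
    and normal: "\<And>u. u \<in> U \<Longrightarrow> N (X u) \<in> normal_plane U X (X u)"
begin

abbreviation dN :: "real ^ 'm \<Rightarrow> real ^ 'm \<Rightarrow> (real ^ 'n) \<times> real" where
  "dN u \<equiv> frechet_derivative (N \<circ> X) (at u)"

lemma has_derivative_normal_field:
  assumes "u \<in> U"
  shows "((N \<circ> X) has_derivative dN u) (at u)"
proof -
  have "Ck_on 1 U (N \<circ> X)"
    using smooth by (simp add: smooth_on_def)
  then show ?thesis
    using assms frechet_derivative_works by auto
qed

text \<open>This moves the derivative from \<open>N\<close> to \<open>X\<close>, where symmetry of
  second derivatives makes the form symmetric in \<open>h\<close> and \<open>k\<close>.\<close>

lemma second_fundamental_form:
  assumes u: "u \<in> U"
  shows "lorentz (dN u h) (dX u k) = - lorentz (N (X u)) (frechet_derivative (\<lambda>y. dX y k) (at u) h)"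
proof -
  have "(\<lambda>y. dX y k) differentiable (at u)"
    using Ck_on_surface[of 2] u by (simp add: numeral_2_eq_2)
  then have "((\<lambda>y. dX y k) has_derivative frechet_derivative (\<lambda>y. dX y k) (at u)) (at u)"
    using frechet_derivative_works by blast
  from lorentz.FDERIV[OF has_derivative_normal_field[OF u] this]
  have "((\<lambda>y. lorentz ((N \<circ> X) y) (dX y k)) has_derivative
     (\<lambda>h. lorentz ((N \<circ> X) u) (frechet_derivative (\<lambda>y. dX y k) (at u) h) + lorentz (dN u h) (dX u k))) (at u)" .
  moreover have "((\<lambda>y. lorentz ((N \<circ> X) y) (dX y k)) has_derivative (\<lambda>h. 0)) (at u)"
    using normal normal_plane_iff
    by (intro has_derivative_const_on_open[OF open_parameters u, where c=0]) simp
  ultimately have "(\<lambda>h. lorentz ((N \<circ> X) u) (frechet_derivative (\<lambda>y. dX y k) (at u) h) +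
      lorentz (dN u h) (dX u k)) = (\<lambda>h. 0)"
    by (rule has_derivative_unique)
  from fun_cong[OF this, of h] show ?thesis
    by simp
qed

lemma flat_surface_imp_normal_derivative:
  assumes flat: "flat_surface U X N" and u: "u \<in> U"
  shows "lorentz (dN u h) (dX u k) = 0"
proof (rule bilinear_eq_0I[where B = "\<lambda>h k. lorentz (dN u h) (dX u k)"
      and g = "\<lambda>h k. lorentz (dX u h) (dX u k)"])
  have lin: "linear (dN u)"
    using has_derivative_normal_field[OF u] has_derivative_linear by blast
  show "bilinear (\<lambda>h k. lorentz (dN u h) (dX u k))" "bilinear (\<lambda>h k. lorentz (dX u h) (dX u k))"
    unfolding bilinear_def using lin linear_dX[OF u]
    by (auto intro!: linearI simp: linear_add linear_scale lorentz.add_left lorentz.add_right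
        lorentz.scaleR_left lorentz.scaleR_right)
  show "lorentz (dN u h) (dX u k) = lorentz (dN u k) (dX u h)" for h k
    using symmetric_second_derivative[OF open_parameters u Ck_on_surface]
    by (simp add: second_fundamental_form[OF u])
  show "lorentz (dX u h) (dX u k) = lorentz (dX u k) (dX u h)" for h k
    by (rule lorentz_commute)
  show "h \<noteq> 0 \<Longrightarrow> lorentz (dX u h) (dX u h) > 0" for h
    by (rule lorentz_dX_pos[OF u])
  fix l h assume "h \<noteq> 0"
    and "\<And>k. lorentz (dN u h) (dX u k) = l * lorentz (dX u h) (dX u k)"
  \<comment> \<open>An eigenvalue \<open>l\<close> of the form relative to the induced metric is a
    principal curvature with the opposite sign.\<close>
  then have "weingarten_map U X N (X u) (dX u h) = (- l) *\<^sub>R dX u h"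
    by (intro weingarten_map_eqI[OF u]) simp
  moreover have "dX u h \<noteq> 0"
    using lorentz_dX_pos[OF u \<open>h \<noteq> 0\<close>] by (auto simp: lorentz.zero_left)
  ultimately have "- l \<in> principal_curvatures U X N (X u)"
    unfolding principal_curvatures_def tangent_space_eq[OF u] by blast
  then show "l = 0"
    using flat u unfolding flat_surface_def by fastforce
qed

lemma flat_surface_imp_constant:
  assumes m: "CARD('m) = CARD('n) - 1" and "connected U" and "r > 0"
    and height: "\<And>u. u \<in> U \<Longrightarrow> snd (N (X u)) = r"
    and sq: "\<And>u. u \<in> U \<Longrightarrow> lorentz (N (X u)) (N (X u)) = 2 * r"
    and flat: "flat_surface U X N"
  shows "N constant_on X ` U"
proof -
  have "((N \<circ> X) has_derivative (\<lambda>h. 0)) (at u)" if u: "u \<in> U" for u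
  proof -
    note dN = has_derivative_normal_field[OF u]
    have "((\<lambda>y. snd ((N \<circ> X) y)) has_derivative (\<lambda>h. 0)) (at u)"
      by (rule has_derivative_const_on_open[OF open_parameters u, where c=r]) (simp add: height)
    with has_derivative_snd[OF dN] have "(\<lambda>h. snd (dN u h)) = (\<lambda>h. 0)"
      by (rule has_derivative_unique)
    then have snd0: "snd (dN u h) = 0" for h
      by metis
    have "((\<lambda>y. lorentz ((N \<circ> X) y) ((N \<circ> X) y)) has_derivative (\<lambda>h. 0)) (at u)"
      by (rule has_derivative_const_on_open[OF open_parameters u, where c="2 * r"]) (simp add: sq)
    with lorentz.FDERIV[OF dN dN]
    have sum0: "(\<lambda>h. lorentz ((N \<circ> X) u) (dN u h) + lorentz (dN u h) ((N \<circ> X) u)) = (\<lambda>h. 0)"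
      by (rule has_derivative_unique)
    have N0: "lorentz (dN u h) (N (X u)) = 0" for h
      using fun_cong[OF sum0, of h] lorentz_commute[of "N (X u)" "dN u h"] by simp
    \<comment> \<open>Since \<open>dN u h\<close> is horizontal, its Lorentz products with tangent
      vectors and with \<open>N\<close> are Euclidean products of first components, so the spanning
      lemma applies.\<close>
    have "fst (dN u h) = 0" for h
    proof (rule fst_dX_normal_span[OF m u normal[OF u]])
      show "snd (N (X u)) \<noteq> 0" "lorentz (N (X u)) (N (X u)) > 0"
        using height[OF u] sq[OF u] \<open>r > 0\<close> by simp_all
      show "fst (dN u h) \<bullet> fst (dX u k) = 0" for k
        using flat_surface_imp_normal_derivative[OF flat u, of h k] by (simp add: lorentz_def snd0)
      show "fst (dN u h) \<bullet> fst (N (X u)) = 0"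
        using N0[of h] by (simp add: lorentz_def snd0)
    qed
    then have "dN u = (\<lambda>h. 0)"
      using snd0 by (auto simp: prod_eq_iff)
    then show ?thesis
      using dN by simp
  qed
  then have "\<exists>c. \<forall>u\<in>U. (N \<circ> X) u = c"
    by (rule has_derivative_zero_connected_const[OF open_parameters \<open>connected U\<close>])
  then show ?thesis
    by (auto simp: constant_on_def)
qed

end

section \<open>Hyperplanes containing the surface, and constancy of a branch\<close>

lemma subset_hyperplane_if_normal:
  assumes "connected U" and a: "\<And>u. u \<in> U \<Longrightarrow> a \<in> normal_plane U X (X u)"
  shows "\<exists>c. X ` U \<subseteq> hyperplane a c"
proof -
  have "((\<lambda>u. lorentz (X u) a) has_derivative (\<lambda>h. 0)) (at u)" if u: "u \<in> U" for u
    using bounded_linear.has_derivative[OF lorentz.bounded_linear_left has_derivative_surface[OF u], of a]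
      a[OF u] u lorentz_commute[of _ a]
    by (simp add: normal_plane_iff)
  then have "\<exists>c. \<forall>u\<in>U. lorentz (X u) a = c"
    by (rule has_derivative_zero_connected_const[OF open_parameters \<open>connected U\<close>])
  then show ?thesis
    by (auto simp: hyperplane_def)
qed

lemma normal_if_subset_hyperplane:
  assumes "X ` U \<subseteq> hyperplane a c" and u: "u \<in> U"
  shows "a \<in> normal_plane U X (X u)"
proof -
  have "((\<lambda>u. lorentz (X u) a) has_derivative (\<lambda>h. 0)) (at u)"
    using assms(1)
    by (intro has_derivative_const_on_open[OF open_parameters u, where c=c]) (auto simp: hyperplane_def)
  with bounded_linear.has_derivative[OF lorentz.bounded_linear_left has_derivative_surface[OF u], of a]
  have "(\<lambda>h. lorentz (dX u h) a) = (\<lambda>h. 0)"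
    by (rule has_derivative_unique)
  then show ?thesis
    using u lorentz_commute[of a] by (simp add: normal_plane_iff fun_eq_iff)
qed

end

text \<open>The sets where \<open>f\<close> and where \<open>g\<close> takes the value
  \<open>b\<close> are relatively closed, cover \<open>S\<close>, and are disjoint because
  \<open>f\<close> and \<open>g\<close> never agree; connectedness empties one of them.\<close>

lemma constant_branch:
  fixes f g :: "'a::topological_space \<Rightarrow> 'b::t1_space"
  assumes "connected S" "continuous_on S f" "continuous_on S g"
    and "\<And>x. x \<in> S \<Longrightarrow> f x \<noteq> g x" and "\<And>x. x \<in> S \<Longrightarrow> f x = b \<or> g x = b"
  shows "(\<forall>x\<in>S. f x = b) \<or> (\<forall>x\<in>S. g x = b)"
proof -
  have "closedin (top_of_set S) (S \<inter> f -` {b})" "closedin (top_of_set S) (S \<inter> g -` {b})"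
    using assms(2,3) by (auto intro: continuous_closedin_preimage)
  moreover have "(S \<inter> f -` {b}) \<union> (S \<inter> g -` {b}) = S" "(S \<inter> f -` {b}) \<inter> (S \<inter> g -` {b}) = {}"
    using assms(4,5) by fastforce+
  ultimately have "S \<inter> f -` {b} = {} \<or> S \<inter> g -` {b} = {}"
    using assms(1)[unfolded connected_closedin_eq] by metis
  then show ?thesis
    using assms(5) by blast
qed

section \<open>Equivalence of flatness, constancy and containment in a hyperplane\<close>

theorem theorem3p2:
  fixes U :: "(real ^ 'm) set"
    and X :: "real ^ 'm \<Rightarrow> (real ^ 'n) \<times> real"
    and n_plus n_minus :: "real \<Rightarrow> (real ^ 'n) \<times> real \<Rightarrow> (real ^ 'n) \<times> real"
  assumes "CARD('n) \<ge> 2" and "CARD('m) = CARD('n) - 1"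
    and "spacelike_surface U X"
    and "connected (X ` U)"
    and "\<And>r. r > 0 \<Longrightarrow> normal_labelling U X r (n_plus r) (n_minus r)"
  shows "((\<exists>r>0. \<exists>N\<in>{n_plus r, n_minus r}. flat_surface U X N) \<longleftrightarrow>
          (\<exists>r>0. \<exists>N\<in>{n_plus r, n_minus r}. N constant_on X ` U)) \<and>
         ((\<exists>r>0. \<exists>N\<in>{n_plus r, n_minus r}. N constant_on X ` U) \<longleftrightarrow>
          (\<exists>a c. spacelike a \<and> snd a \<noteq> 0 \<and> X ` U \<subseteq> hyperplane a c))"
proof -
  note surf = assms(3)
  \<comment> \<open>Connectedness is given for the image, but the vanishing-derivative arguments run
    on the parameter domain.\<close>
  have U: "connected U"
  proof -
    obtain Y where "homeomorphism U (X ` U) X Y"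
      using surf by (auto simp: spacelike_surface_def)
    then show ?thesis
      using assms(4) homeomorphic_connectedness homeomorphic_def by blast
  qed
  have branch: "N p \<in> normal_plane U X p \<and> snd (N p) = r \<and> lorentz (N p) (N p) = 2 * r"
    if "r > 0" "N \<in> {n_plus r, n_minus r}" "p \<in> X ` U" for r N p
  proof -
    have "N p \<in> normal_plane U X p \<inter> hyp_plus \<inter> {x. snd x = r}"
      using assms(5)[OF that(1)] that(2,3) unfolding normal_labelling_def by blast
    then show ?thesis
      using hyp_plus_height_iff[OF that(1), of "N p"] by auto
  qed
  have smooth: "smooth_on U (N \<circ> X)" if "r > 0" "N \<in> {n_plus r, n_minus r}" for r N
    using assms(5)[OF that(1)] that(2) by (auto simp: normal_labelling_def)

  have "N constant_on X ` U" if "r > 0" "N \<in> {n_plus r, n_minus r}" "flat_surface U X N" for r N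
    using flat_surface_imp_constant[OF surf smooth[OF that(1,2)] _ assms(2) U that(1) _ _ that(3)]
      branch[OF that(1,2)] by blast
  moreover have "flat_surface U X N" if "N constant_on X ` U" for N
    using flat_surface_const[OF surf that] .
  moreover have "\<exists>a c. spacelike a \<and> snd a \<noteq> 0 \<and> X ` U \<subseteq> hyperplane a c"
    if r: "r > 0" "N \<in> {n_plus r, n_minus r}" "N constant_on X ` U" for r N
  proof (cases "U = {}")
    case True
    \<comment> \<open>The empty surface offers no value of \<open>N\<close> to use as normal vector.
      Any spacelike vector with nonzero last coordinate serves; \<open>(b, 1)\<close> has Lorentz
      square 3.\<close>
    obtain b :: "real ^ 'n" where "norm b = 2"
      using vector_choose_size[of 2] by auto
    then have "spacelike (b, 1::real) \<and> snd (b, 1::real) \<noteq> 0"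
      by (simp add: spacelike_def lorentz_def dot_square_norm zero_prod_def)
    then show ?thesis
      using True by blast
  next
    case False
    obtain a where a: "\<And>p. p \<in> X ` U \<Longrightarrow> N p = a"
      using r(3) unfolding constant_on_def by blast
    have "a \<in> normal_plane U X (X u) \<and> snd a = r \<and> lorentz a a = 2 * r" if "u \<in> U" for u
      using branch[OF r(1,2) imageI[OF that]] a[OF imageI[OF that]] by simp
    then have "lorentz a a > 0" "snd a \<noteq> 0" and "\<And>u. u \<in> U \<Longrightarrow> a \<in> normal_plane U X (X u)"
      using False r(1) by auto
    moreover from this have "spacelike a"
      by (auto simp: spacelike_def)
    ultimately show ?thesis
      using subset_hyperplane_if_normal[OF surf U] by blast
  qed
  moreover have "\<exists>r>0. \<exists>N\<in>{n_plus r, n_minus r}. N constant_on X ` U"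
    if a: "spacelike a" "snd a \<noteq> 0" "X ` U \<subseteq> hyperplane a c" for a c
  proof -
    define l where "l = lorentz a a"
    have "l > 0"
      using a(1) by (simp add: l_def spacelike_def)
    \<comment> \<open>The multiple of \<open>a\<close> at height \<open>r\<close> has Lorentz square
      \<open>(r / snd a)\<^sup>2 * l\<close>; equating this with \<open>2 * r\<close> determines
      \<open>r\<close>.\<close>
    define r where "r = 2 * (snd a)\<^sup>2 / l"
    define b where "b = (r / snd a) *\<^sub>R a"
    have "r > 0"
      using \<open>l > 0\<close> a(2) by (simp add: r_def)
    have "snd b = r"
      using a(2) by (simp add: b_def)
    moreover have "lorentz b b = 2 * r"
      using \<open>l > 0\<close> a(2)
      by (simp add: b_def lorentz.scaleR_left lorentz.scaleR_right l_def[symmetric] r_def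
          field_simps power2_eq_square)
    ultimately have b: "b \<in> hyp_plus \<inter> {x. snd x = r}"
      using hyp_plus_height_iff[OF \<open>r > 0\<close>, of b] by blast
    have eq: "n_plus r (X u) = b \<or> n_minus r (X u) = b" if u: "u \<in> U" for u
    proof -
      have "b \<in> normal_plane U X (X u)"
        using normal_if_subset_hyperplane[OF surf a(3) u]
        by (simp add: normal_plane_def b_def lorentz.scaleR_left)
      moreover have "normal_plane U X (X u) \<inter> hyp_plus \<inter> {x. snd x = r} = {n_plus r (X u), n_minus r (X u)}"
        using assms(5)[OF \<open>r > 0\<close>] u by (simp add: normal_labelling_def)
      ultimately have "b \<in> {n_plus r (X u), n_minus r (X u)}"
        using b by (metis IntI Int_assoc)
      then show ?thesis
        by blast
    qed
    have cont: "continuous_on U (N \<circ> X)" if "N \<in> {n_plus r, n_minus r}" for N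
      using smooth[OF \<open>r > 0\<close> that] unfolding smooth_on_def by (metis Ck_on.simps(1))
    \<comment> \<open>Pointwise, the branch that meets \<open>b\<close> could still vary with
      \<open>u\<close>; connectedness fixes it.\<close>
    have "(\<forall>u\<in>U. (n_plus r \<circ> X) u = b) \<or> (\<forall>u\<in>U. (n_minus r \<circ> X) u = b)"
      using assms(5)[OF \<open>r > 0\<close>] eq
      by (intro constant_branch U cont) (auto simp: normal_labelling_def)
    then have "n_plus r constant_on X ` U \<or> n_minus r constant_on X ` U"
      by (auto simp: constant_on_def)
    then show ?thesis
      using \<open>r > 0\<close> by blast
  qed
  ultimately show ?thesis
    by (intro conjI iffI; elim exE conjE bexE; metis)
qed

end
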